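(* Let $n > t \ge 0$ be integers and let $X$ be any set with $|X| \ge 2$. If $B_1, B_2, \dots, B_m$ are Hamming balls in $X^n$ of radius $t$, then there exists $I \subseteq [m]$ with $|I| \le 2^{t+1}$ such that $\bigcap_{i=1}^m B_i = \bigcap_{i \in I} B_i$.
   Context: For $p,q \in X^n$, $\mathrm{dist}(p,q)$ is the number of coordinates in which $p$ and $q$ differ (Hamming distance). The Hamming ball of radius $t$ centered at $x \in X^n$ is $B(x,t) = \{p \in X^n : \mathrm{dist}(p,x) \le t\}$. $[m] = \{1,\dots,m\}$. *)

theory Defs
  imports Main "HOL-Library.FuncSet"
begin

abbreviation cart_power :: "'a set \<Rightarrow> nat \<Rightarrow> (nat \<Rightarrow> 'a) set" where
  "cart_power X n \<equiv> {1..n} \<rightarrow>\<^sub>E X"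

definition hamming_dist :: "nat \<Rightarrow> (nat \<Rightarrow> 'a) \<Rightarrow> (nat \<Rightarrow> 'a) \<Rightarrow> nat" where
  "hamming_dist n p q = card {i \<in> {1..n}. p i \<noteq> q i}"

definition hamming_ball :: "'a set \<Rightarrow> nat \<Rightarrow> (nat \<Rightarrow> 'a) \<Rightarrow> nat \<Rightarrow> (nat \<Rightarrow> 'a) set" where
  "hamming_ball X n x t = {p \<in> cart_power X n. hamming_dist n p x \<le> t}"

end

theory Submission
  imports Defs Complex_Main
begin

text \<open>
  In an irredundant subfamily each ball centre \<open>b\<^sub>i\<close> has a partner \<open>a\<^sub>i\<close> with
  \<open>dist(a\<^sub>i, b\<^sub>i) > t\<close> and \<open>dist(a\<^sub>i, b\<^sub>j) \<le> t\<close> for \<open>i \<noteq> j\<close>. To bound the number of such pairs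
  independently of \<open>n\<close>, each pair is assigned not one vector but a space of at least
  \<open>2\<^bsup>n-t-1\<^esup>\<close> dimensions inside the \<open>2\<^sup>n\<close>-dimensional space of multilinear polynomials
  in \<open>n\<close> variables. For a set \<open>U\<close> of coordinates, let the point \<open>p\<close> be \<open>a\<^sub>i\<close> off \<open>U\<close>, and on \<open>U\<close> equal
  to \<open>b\<^sub>i\<close> where \<open>a\<^sub>i\<close> and \<open>b\<^sub>i\<close> differ and to an extra symbol where they agree; let \<open>q\<close> be obtained
  by exchanging the two values at every coordinate. The pairing of \<open>p\<close> with \<open>q'\<close> is the product of
  the coordinate differences, hence nonzero iff \<open>p\<close> and \<open>q'\<close> differ everywhere. If \<open>U\<close> is restricted
  to meet the difference set of \<open>a\<^sub>i\<close> and \<open>b\<^sub>i\<close> in few elements (with a tie-break when the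
  parity is wrong), the pairing matrix becomes triangular, so the spaces are independent.
\<close>

section \<open>The dimension argument\<close>

text \<open>Gaussian elimination by induction on the coordinates: a pivot \<open>z\<close> with
  nonzero entry at \<open>s0\<close> clears that coordinate from all other vectors.\<close>

lemma exists_nontrivial_relation:
  fixes f :: "'j \<Rightarrow> 's \<Rightarrow> 'b::field"
  assumes "finite S" "finite J" "card S < card J"
  shows "\<exists>c. (\<exists>x\<in>J. c x \<noteq> 0) \<and> (\<forall>s\<in>S. (\<Sum>x\<in>J. c x * f x s) = 0)"
  using assms
proof (induction S arbitrary: J f rule: finite_induct)
  case empty
  then have "J \<noteq> {}" by auto
  then show ?case by (intro exI[of _ "\<lambda>_. 1"]) auto
next
  case (insert s0 S)
  show ?case
  proof (cases "\<forall>x\<in>J. f x s0 = 0")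
    case True
    obtain c where "\<exists>x\<in>J. c x \<noteq> 0" "\<forall>s\<in>S. (\<Sum>x\<in>J. c x * f x s) = 0"
      using insert.IH[of J f] insert.hyps insert.prems by (metis Suc_lessD card_insert_disjoint)
    with True show ?thesis by (intro exI[of _ c]) auto
  next
    case False
    then obtain z where z: "z \<in> J" "f z s0 \<noteq> 0" by blast
    define g where "g x s = f x s - f x s0 / f z s0 * f z s" for x s
    have "card S < card (J - {z})" using insert z by simp
    then obtain c where c: "\<exists>x\<in>J - {z}. c x \<noteq> 0"
        "\<forall>s\<in>S. (\<Sum>x\<in>J - {z}. c x * g x s) = 0"
      using insert.IH[of "J - {z}" g] insert.prems by (metis finite_Diff)
    \<comment> \<open>This coefficient of \<open>z\<close> makes the combination vanish at
      \<open>s0\<close>.\<close>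
    define w where "w = - (\<Sum>x\<in>J - {z}. c x * f x s0) / f z s0"
    define c' where "c' = c(z := w)"
    have split: "(\<Sum>x\<in>J. c' x * f x s) = w * f z s + (\<Sum>x\<in>J - {z}. c x * f x s)" for s
      using z insert.prems by (simp add: sum.remove[of J z] c'_def)
    have reduced: "(\<Sum>x\<in>J - {z}. c x * g x s)
        = (\<Sum>x\<in>J - {z}. c x * f x s) + w * f z s" for s
    proof -
      have "c x * g x s = c x * f x s - c x * f x s0 * (f z s / f z s0)" for x
        by (simp add: g_def algebra_simps)
      then have "(\<Sum>x\<in>J - {z}. c x * g x s)
          = (\<Sum>x\<in>J - {z}. c x * f x s) - (\<Sum>x\<in>J - {z}. c x * f x s0) * (f z s / f z s0)"
        by (simp only: sum_subtractf sum_distrib_right)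
      then show ?thesis by (simp add: w_def)
    qed
    have "(\<Sum>x\<in>J. c' x * f x s) = 0" if "s \<in> insert s0 S" for s
    proof (cases "s = s0")
      case True
      then show ?thesis using z by (simp add: split w_def)
    next
      case False
      then have "s \<in> S" using that by simp
      with c(2) have "(\<Sum>x\<in>J - {z}. c x * g x s) = 0" by blast
      then show ?thesis using reduced[of s] by (simp add: split add.commute)
    qed
    moreover have "\<exists>x\<in>J. c' x \<noteq> 0" using c(1) by (auto simp: c'_def)
    ultimately show ?thesis by blast
  qed
qed

text \<open>With more than \<open>card S\<close> indices the \<open>f x\<close> satisfy a linear
  relation. Pairing it with \<open>g y\<close>, for \<open>y\<close> of maximal rank in its support,
  leaves only the nonzero diagonal term.\<close>

lemma card_le_of_triangular_pairing:
  fixes f g :: "'j \<Rightarrow> 's \<Rightarrow> 'b::field" and rank :: "'j \<Rightarrow> 'r::linorder"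
  assumes "finite S" "finite J"
    and diag: "\<And>x. x \<in> J \<Longrightarrow> (\<Sum>s\<in>S. f x s * g x s) \<noteq> 0"
    and off_diag: "\<And>x y. \<lbrakk>x \<in> J; y \<in> J; x \<noteq> y; (\<Sum>s\<in>S. f x s * g y s) \<noteq> 0\<rbrakk> \<Longrightarrow> rank y < rank x"
  shows "card J \<le> card S"
proof (rule ccontr)
  assume "\<not> card J \<le> card S"
  then obtain c where c: "\<exists>x\<in>J. c x \<noteq> 0" "\<forall>s\<in>S. (\<Sum>x\<in>J. c x * f x s) = 0"
    using exists_nontrivial_relation[of S J f] assms by auto
  define K where "K = {x\<in>J. c x \<noteq> 0}"
  have K: "finite K" "K \<noteq> {}" using c assms by (auto simp: K_def)
  obtain y where y: "y \<in> K" "\<And>x. x \<in> K \<Longrightarrow> rank x \<le> rank y"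
    using K Max_in[of "rank ` K"] Max_ge[of "rank ` K"] by (smt (verit) finite_imageI image_is_empty imageE imageI)
  have yJ: "y \<in> J" "c y \<noteq> 0" using y by (auto simp: K_def)
  have "0 = (\<Sum>s\<in>S. (\<Sum>x\<in>J. c x * f x s) * g y s)" using c by simp
  also have "\<dots> = (\<Sum>x\<in>J. c x * (\<Sum>s\<in>S. f x s * g y s))"
    unfolding sum_distrib_right sum_distrib_left mult.assoc by (rule sum.swap)
  also have "\<dots> = (\<Sum>x\<in>J. if x = y then c y * (\<Sum>s\<in>S. f y s * g y s) else 0)"
  proof (rule sum.cong)
    fix x assume "x \<in> J"
    show "c x * (\<Sum>s\<in>S. f x s * g y s) = (if x = y then c y * (\<Sum>s\<in>S. f y s * g y s) else 0)"
    proof (cases "x = y \<or> c x = 0")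
      case False
      then have "\<not> rank y < rank x" using y(2)[of x] \<open>x \<in> J\<close> by (simp add: K_def)
      then show ?thesis using off_diag[OF \<open>x \<in> J\<close> yJ(1)] False by auto
    qed auto
  qed simp
  also have "\<dots> = c y * (\<Sum>s\<in>S. f y s * g y s)" using yJ assms by simp
  finally show False using diag yJ by simp
qed

text \<open>Expanding the product of the differences over the subsets of \<open>N\<close> turns it
  into a scalar product with \<open>2 ^ card N\<close> coordinates.\<close>

lemma card_le_of_triangular_points:
  fixes P Q :: "'j \<Rightarrow> 'k \<Rightarrow> 'c" and rank :: "'j \<Rightarrow> 'r::linorder"
  assumes "finite N" "finite J"
    and diag: "\<And>x k. \<lbrakk>x \<in> J; k \<in> N\<rbrakk> \<Longrightarrow> P x k \<noteq> Q x k"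
    and off_diag: "\<And>x y. \<lbrakk>x \<in> J; y \<in> J; x \<noteq> y; \<forall>k\<in>N. P x k \<noteq> Q y k\<rbrakk> \<Longrightarrow> rank y < rank x"
  shows "card J \<le> 2 ^ card N"
proof -
  define Y where "Y = (\<Union>x\<in>J. P x ` N \<union> Q x ` N)"
  have "finite Y" using assms by (auto simp: Y_def)
  \<comment> \<open>Only finitely many symbols occur, so they can be coded by distinct numbers even
    over an infinite alphabet.\<close>
  then obtain e :: "'c \<Rightarrow> nat" where e: "inj_on e Y"
    using finite_imp_inj_to_nat_seg[of Y] by auto
  define f where "f x A = (\<Prod>k\<in>A. rat_of_nat (e (P x k)))" for x A
  define g where "g x A = (\<Prod>k\<in>N - A. - rat_of_nat (e (Q x k)))" for x A
  have "(\<Sum>A\<in>Pow N. f x A * g y A) = (\<Prod>k\<in>N. rat_of_nat (e (P x k)) - rat_of_nat (e (Q y k)))"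
    for x y
    using prod_add[OF \<open>finite N\<close>, of "\<lambda>k. rat_of_nat (e (P x k))" "\<lambda>k. - rat_of_nat (e (Q y k))"]
    by (simp add: f_def g_def)
  moreover have "e (P x k) = e (Q y k) \<longleftrightarrow> P x k = Q y k" if "x \<in> J" "y \<in> J" "k \<in> N" for x y k
    using inj_on_eq_iff[OF e, of "P x k" "Q y k"] that by (auto simp: Y_def)
  ultimately have pairing: "(\<Sum>A\<in>Pow N. f x A * g y A) \<noteq> 0 \<longleftrightarrow> (\<forall>k\<in>N. P x k \<noteq> Q y k)"
    if "x \<in> J" "y \<in> J" for x y
    using that \<open>finite N\<close> by simp
  have "card J \<le> card (Pow N)"
  proof (rule card_le_of_triangular_pairing)
    show "finite (Pow N)" "finite J" using assms by auto
    show "(\<Sum>A\<in>Pow N. f x A * g x A) \<noteq> 0" if "x \<in> J" for x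
      using that diag pairing by simp
    show "rank y < rank x"
      if "x \<in> J" "y \<in> J" "x \<noteq> y" "(\<Sum>A\<in>Pow N. f x A * g y A) \<noteq> 0" for x y
      using that off_diag pairing by metis
  qed
  then show ?thesis using \<open>finite N\<close> by (simp add: card_Pow)
qed

section \<open>Counting the admissible sets\<close>

text \<open>
  The second alternative is the tie-break: when \<open>card D - t\<close> is even, the first one alone
  can admit fewer than \<open>2\<^bsup>card D - t - 1\<^esup>\<close> sets, for instance if \<open>card D = t + 2\<close>.
\<close>

definition light_sets :: "nat \<Rightarrow> nat set \<Rightarrow> nat set set" where
  "light_sets t D =
     {M. M \<subseteq> D \<and> (t + 1 + 2 * card M \<le> card D \<or> card D = t + 2 * card M \<and> Min D \<in> M)}"

text \<open>As \<open>card E\<close> is odd, complementation pairs these subsets with the remaining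
  ones, so they are half of all.\<close>

lemma card_lower_half_subsets:
  assumes "finite E" "card E = 2 * l + 1"
  shows "card {M. M \<subseteq> E \<and> card M \<le> l} = 2 ^ (2 * l)"
proof -
  have "{M. M \<subseteq> E \<and> card M \<le> l} = (\<Union>k\<le>l. {M. M \<subseteq> E \<and> card M = k})" by auto
  also have "card \<dots> = (\<Sum>k\<le>l. card {M. M \<subseteq> E \<and> card M = k})"
    using assms by (intro card_UN_disjoint) auto
  also have "\<dots> = 2 ^ (2 * l)"
    unfolding n_subsets[OF assms(1)] assms(2) by (rule binomial_r_part_sum)
  finally show ?thesis .
qed

lemma card_light_sets:
  assumes "finite D" "t < card D"
  shows "2 ^ (card D - (t + 1)) \<le> card (light_sets t D)"
proof -
  have fin: "finite (light_sets t D)"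
    using assms by (auto simp: light_sets_def intro: finite_subset[of _ "Pow D"])
  have "D \<noteq> {}" using assms by auto
  then have minD: "Min D \<in> D" using assms by simp
  show ?thesis
  proof (cases "even (card D - (t + 1))")
    case True
    then obtain l where "card D - (t + 1) = 2 * l" by blast
    then have l: "card D = t + 1 + 2 * l" using assms by simp
    \<comment> \<open>Here \<open>card E = card D - t\<close>, and every subset of \<open>E\<close>
      below half size satisfies the first alternative.\<close>
    then obtain E where E: "E \<subseteq> D" "card E = 2 * l + 1" "finite E"
      using obtain_subset_with_card_n[of "2 * l + 1" D] by auto
    have "card {M. M \<subseteq> E \<and> card M \<le> l} \<le> card (light_sets t D)"
      using E l by (intro card_mono fin) (auto simp: light_sets_def)
    then show ?thesis using card_lower_half_subsets[of E l] E l by simp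
  next
    case False
    then obtain l where "card D - (t + 1) = 2 * l + 1" by (blast elim: oddE)
    then have l: "card D = t + 2 + 2 * l" using assms by simp
    \<comment> \<open>Reserving \<open>Min D\<close> doubles the count: each small subset of
      \<open>E\<close> is light with and without it, and the tie-break is needed only at size
      \<open>l + 1\<close>.\<close>
    then have "2 * l + 1 \<le> card (D - {Min D})" using minD by simp
    then obtain E where E: "E \<subseteq> D - {Min D}" "card E = 2 * l + 1" "finite E"
      using obtain_subset_with_card_n[of "2 * l + 1" "D - {Min D}"] by auto
    define G where "G = {M. M \<subseteq> E \<and> card M \<le> l}"
    have G: "finite G" "card G = 2 ^ (2 * l)"
      using E card_lower_half_subsets[of E l] by (auto simp: G_def)
    have notin: "Min D \<notin> M" "finite M" if "M \<in> G" for M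
      using that E by (auto simp: G_def finite_subset)
    have "inj_on (insert (Min D)) G"
      using notin by (intro inj_onI) (metis insert_ident)
    then have "card (insert (Min D) ` G) = card G" by (rule card_image)
    moreover have "G \<inter> insert (Min D) ` G = {}" using notin by auto
    ultimately have "card (G \<union> insert (Min D) ` G) = 2 * card G"
      using G by (simp add: card_Un_disjoint)
    moreover have "card (G \<union> insert (Min D) ` G) \<le> card (light_sets t D)"
    proof (intro card_mono fin Un_least subsetI)
      fix M assume "M \<in> G"
      then show "M \<in> light_sets t D" using E l by (auto simp: light_sets_def G_def)
    next
      fix M assume "M \<in> insert (Min D) ` G"
      then obtain M' where M': "M' \<in> G" "M = insert (Min D) M'" by blast
      then have "card M = card M' + 1" using notin[of M'] by simp
      moreover have "card M' \<le> l" "M \<subseteq> D" using M' E minD by (auto simp: G_def)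
      ultimately show "M \<in> light_sets t D" using M' l by (auto simp: light_sets_def)
    qed
    ultimately show ?thesis using G l by simp
  qed
qed

lemma card_sets_with_trace:
  assumes "finite N" "D \<subseteq> N" "L \<subseteq> Pow D"
  shows "card {U. U \<subseteq> N \<and> U \<inter> D \<in> L} = card L * 2 ^ (card N - card D)"
proof -
  have "bij_betw (\<lambda>(M, V). M \<union> V) (L \<times> Pow (N - D)) {U. U \<subseteq> N \<and> U \<inter> D \<in> L}"
  proof (rule bij_betw_byWitness[where f' = "\<lambda>U. (U \<inter> D, U - D)"])
    have "(M \<union> V) \<inter> D = M" if "M \<in> L" "V \<subseteq> N - D" for M V using that assms by blast
    then show "(\<lambda>(M, V). M \<union> V) ` (L \<times> Pow (N - D)) \<subseteq> {U. U \<subseteq> N \<and> U \<inter> D \<in> L}"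
      using assms by auto
  qed (use assms in auto)
  then have "card {U. U \<subseteq> N \<and> U \<inter> D \<in> L} = card (L \<times> Pow (N - D))"
    by (rule bij_betw_same_card[symmetric])
  also have "\<dots> = card L * 2 ^ (card N - card D)"
    using assms card_Diff_subset[of D N]
    by (simp add: card_cartesian_product card_Pow finite_subset[OF assms(2,1)])
  finally show ?thesis .
qed

section \<open>The triangular order\<close>

text \<open>
  On subsets of \<open>{1..n}\<close> the sum is less than \<open>2\<^sup>n\<close>, so it only decides between sets of equal
  cardinality, where it makes the rank decrease along the lexicographic order.
\<close>

definition set_rank :: "nat \<Rightarrow> nat set \<Rightarrow> int" where
  "set_rank n U = int (card U) * 2 ^ n - (\<Sum>k\<in>U. 2 ^ (n - k))"

text \<open>The weights beyond \<open>k0\<close> form a geometric sum of value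
  \<open>2 ^ (n - k0) - 1\<close>; hence the first differing index decides a tie.\<close>

lemma sum_powers_above:
  assumes "k0 \<le> n" "V \<subseteq> {k0<..n}"
  shows "(\<Sum>k\<in>V. 2 ^ (n - k)) < (2::int) ^ (n - k0)"
proof -
  have "(\<Sum>k\<in>V. 2 ^ (n - k)) \<le> (\<Sum>k\<in>{k0<..n}. (2::int) ^ (n - k))"
    using assms by (intro sum_mono2) auto
  also have "\<dots> = (\<Sum>j<n - k0. 2 ^ j)"
    by (rule sum.reindex_bij_witness[of _ "\<lambda>j. n - j" "\<lambda>k. n - k"]) auto
  also have "\<dots> = 2 ^ (n - k0) - 1"
    using power_diff_1_eq[of "2::int" "n - k0"] by simp
  finally show ?thesis by simp
qed

lemma set_rank_less_if_card_less:
  assumes "U \<subseteq> {1..n}" "V \<subseteq> {1..n}" "card V < card U"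
  shows "set_rank n V < set_rank n U"
proof -
  have "(\<Sum>k\<in>U. 2 ^ (n - k)) < (2::int) ^ n" using sum_powers_above[of 0 n U] assms by fastforce
  moreover have "(0::int) \<le> (\<Sum>k\<in>V. 2 ^ (n - k))" by (simp add: sum_nonneg)
  moreover have "(int (card V) + 1) * 2 ^ n \<le> int (card U) * 2 ^ n"
    using assms by (intro mult_right_mono) auto
  ultimately show ?thesis by (simp add: set_rank_def algebra_simps)
qed

lemma set_rank_less_if_tie:
  assumes "U \<subseteq> {1..n}" "V \<subseteq> {1..n}" "card V = card U"
    and "k0 \<in> V - U" "\<And>k. k \<in> U - V \<Longrightarrow> k0 < k"
  shows "set_rank n V < set_rank n U"
proof -
  have fin: "finite U" "finite V" using assms by (simp_all add: finite_subset)
  have diff: "(\<Sum>k\<in>A. 2 ^ (n - k)) = (\<Sum>k\<in>A \<inter> B. 2 ^ (n - k)) + (\<Sum>k\<in>A - B. (2::int) ^ (n - k))"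
    if "finite A" for A B using that by (rule sum.Int_Diff)
  have "(\<Sum>k\<in>U - V. 2 ^ (n - k)) < (2::int) ^ (n - k0)"
    using assms by (intro sum_powers_above) auto
  also have "\<dots> \<le> (\<Sum>k\<in>V - U. 2 ^ (n - k))"
    using assms fin by (intro member_le_sum) auto
  finally have "(\<Sum>k\<in>U. 2 ^ (n - k)) < (\<Sum>k\<in>V. (2::int) ^ (n - k))"
    using diff[of U V] diff[of V U] fin by (simp add: Int_commute)
  then show ?thesis using assms by (simp add: set_rank_def)
qed

section \<open>The bound on the number of pairs\<close>

lemma card_Diff_Un_ge:
  assumes "finite N" "card (N - (U \<union> S)) \<le> t" "U \<subseteq> N" "S \<subseteq> N"
  shows "card N \<le> t + card (U \<union> S)"
  using assms card_Diff_subset[of "U \<union> S" N] finite_subset[of "U \<union> S" N] by simp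

text \<open>Each \<open>i\<close> supplies at least \<open>2 ^ (n - (t + 1))\<close> labels
  \<open>(i, U)\<close>, and triangularity allows at most \<open>2 ^ n\<close> labels in
  all.\<close>

lemma card_pairs_le:
  fixes a b :: "'i \<Rightarrow> nat \<Rightarrow> 'a"
  assumes "finite I"
    and diag: "\<And>i. i \<in> I \<Longrightarrow> t < hamming_dist n (a i) (b i)"
    and off_diag: "\<And>i j. \<lbrakk>i \<in> I; j \<in> I; i \<noteq> j\<rbrakk> \<Longrightarrow> hamming_dist n (a i) (b j) \<le> t"
  shows "card I \<le> 2 ^ (t + 1)"
proof (cases "I = {}")
  case False
  define N where "N = {1..n}"
  have N: "finite N" "card N = n" by (simp_all add: N_def)
  define D where "D i = {k \<in> N. a i k \<noteq> b i k}" for i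
  have D: "D i \<subseteq> N" "finite (D i)" for i using N by (auto simp: D_def)
  have cardD: "t < card (D i)" if "i \<in> I" for i
    using diag[OF that] by (simp add: D_def N_def hamming_dist_def)
  have D_le: "card (D i) \<le> n" for i using D N card_mono by metis
  define F where "F i = {U. U \<subseteq> N \<and> U \<inter> D i \<in> light_sets t (D i)}" for i
  define J where "J = Sigma I F"
  define alt where "alt i k = (if k \<in> D i then Some (b i k) else None)" for i k
  define P where "P x k = (if k \<in> snd x then alt (fst x) k else Some (a (fst x) k))" for x k
  define Q where "Q x k = (if k \<in> snd x then Some (a (fst x) k) else alt (fst x) k)" for x k
  have finJ: "finite J"
    using N \<open>finite I\<close> by (auto simp: J_def F_def intro: finite_subset[of _ "Pow N"])
  have alt_neq: "alt i k \<noteq> Some (a i k)" if "k \<in> N" for i k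
    using that by (auto simp: alt_def D_def)
  have triangular: "set_rank n (snd y) < set_rank n (snd x)"
    if "x \<in> J" "y \<in> J" "x \<noteq> y" and PQ: "\<forall>k\<in>N. P x k \<noteq> Q y k" for x y
  proof -
    obtain i U j V where xy: "x = (i, U)" "y = (j, V)" by (metis surj_pair)
    have ij: "i \<in> I" "j \<in> I" and U: "U \<subseteq> N" and V: "V \<subseteq> N"
      and light: "V \<inter> D j \<in> light_sets t (D j)"
      using that by (auto simp: J_def F_def xy)
    have fin: "finite U" "finite V" using U V N finite_subset by auto
    \<comment> \<open>For equal indices, \<open>P x\<close> and \<open>Q y\<close> agree wherever
      exactly one of \<open>U\<close> and \<open>V\<close> contains the coordinate.\<close>
    have "i \<noteq> j"
    proof
      assume "i = j"
      have "k \<in> U \<longleftrightarrow> k \<in> V" if "k \<in> N" for k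
        using PQ that by (auto simp: P_def Q_def xy \<open>i = j\<close> split: if_splits)
      then show False using U V \<open>x \<noteq> y\<close> \<open>i = j\<close> xy by blast
    qed
    \<comment> \<open>the coordinates at which \<open>Q y\<close> differs from \<open>b j\<close>\<close>
    define S where "S = (V \<inter> D j) \<union> (N - D j - V)"
    have S: "S \<subseteq> N" using V by (auto simp: S_def)
    \<comment> \<open>Outside \<open>U\<close> and \<open>S\<close> the compared symbols are those
      of \<open>a i\<close> and \<open>b j\<close>; they must differ, which can happen at most
      \<open>t\<close> times.\<close>
    have "k \<in> U \<union> S" if "k \<in> N" "a i k = b j k" for k
    proof (rule ccontr)
      assume "k \<notin> U \<union> S"
      then have "Q y k = Some (b j k)"
        using \<open>k \<in> N\<close> by (auto simp: Q_def xy S_def alt_def D_def)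
      moreover have "P x k = Some (a i k)" using \<open>k \<notin> U \<union> S\<close> by (simp add: P_def xy)
      ultimately show False using PQ that by metis
    qed
    then have "N - (U \<union> S) \<subseteq> {k \<in> {1..n}. a i k \<noteq> b j k}" unfolding N_def by blast
    then have "card (N - (U \<union> S)) \<le> hamming_dist n (a i) (b j)"
      unfolding hamming_dist_def by (intro card_mono) auto
    then have n_le: "n \<le> t + card (U \<union> S)"
      using card_Diff_Un_ge[of N U S t] off_diag[OF ij \<open>i \<noteq> j\<close>] N U S by simp
    have "card S = card (V \<inter> D j) + card (N - D j - V)"
      unfolding S_def using N fin by (intro card_Un_disjoint) auto
    moreover have "card (N - D j - V) + card (V - D j) = card (N - D j)"
    proof -
      have "N - D j = (N - D j - V) \<union> (V - D j)" using V by auto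
      then show ?thesis using N fin
        by (subst card_Un_disjoint[symmetric]) auto
    qed
    moreover have "card (N - D j) = n - card (D j)"
      using D N by (simp add: card_Diff_subset)
    moreover have "card V = card (V \<inter> D j) + card (V - D j)"
      using fin card_Int_Diff by blast
    ultimately have cardS: "card S + card (D j) + card V = n + 2 * card (V \<inter> D j)"
      using D_le[of j] by simp
    have Un_Int: "card U + card S = card (U \<union> S) + card (U \<inter> S)"
      using fin S N by (intro card_Un_Int) (auto intro: finite_subset)
    \<comment> \<open>The counts combine to \<open>card V + card (D j) + card (U \<inter> S) \<le> t
      + card U + 2 * card (V \<inter> D j)\<close>; lightness of \<open>V\<close> bounds
      \<open>card (D j)\<close> from below.\<close>
    consider "card V < card U" | "card V = card U" "card (U \<inter> S) = 0"
        "card (D j) = t + 2 * card (V \<inter> D j)" "Min (D j) \<in> V \<inter> D j"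
    proof -
      from light consider "t + 1 + 2 * card (V \<inter> D j) \<le> card (D j)"
        | "card (D j) = t + 2 * card (V \<inter> D j)" "Min (D j) \<in> V \<inter> D j"
        by (auto simp: light_sets_def)
      then show thesis
      proof cases
        case 1
        then have "card V < card U" using n_le cardS Un_Int by linarith
        then show thesis by (rule that(1))
      next
        case 2
        then have "card V < card U \<or> card V = card U \<and> card (U \<inter> S) = 0"
          using n_le cardS Un_Int by linarith
        then show thesis using 2 that by blast
      qed
    qed
    then show ?thesis
    proof cases
      case 1
      then show ?thesis using U V by (simp add: xy N_def set_rank_less_if_card_less)
    next
      case 2
      \<comment> \<open>Disjointness from \<open>S\<close> forces \<open>U - V\<close> into
        \<open>D j\<close> and keeps \<open>Min (D j)\<close> out of \<open>U\<close>, so this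
        minimum is the deciding index.\<close>
      then have disj: "U \<inter> S = {}" using fin by simp
      have "Min (D j) < k" if "k \<in> U - V" for k
      proof -
        have "k \<in> D j" using that disj U by (auto simp: S_def)
        moreover have "k \<noteq> Min (D j)" using that 2 by auto
        ultimately show ?thesis using D[of j] by (simp add: order_less_le)
      qed
      moreover have "Min (D j) \<in> V - U" using 2 disj by (auto simp: S_def)
      ultimately show ?thesis using set_rank_less_if_tie[of U n V "Min (D j)"] U V 2
        by (simp add: xy N_def)
    qed
  qed
  have "card J \<le> 2 ^ card N"
  proof (rule card_le_of_triangular_points[OF N(1) finJ _ triangular])
    fix x k assume "k \<in> N"
    then show "P x k \<noteq> Q x k"
      using alt_neq[of k "fst x"] by (auto simp: P_def Q_def)
  qed
  moreover have "card I * 2 ^ (n - (t + 1)) \<le> card J"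
  proof -
    have "2 ^ (n - (t + 1)) \<le> card (F i)" if "i \<in> I" for i
    proof -
      have "card (F i) = card (light_sets t (D i)) * 2 ^ (n - card (D i))"
        unfolding F_def using card_sets_with_trace[of N "D i" "light_sets t (D i)"] N D
        by (auto simp: light_sets_def)
      moreover have "(2::nat) ^ (n - (t + 1)) = 2 ^ (card (D i) - (t + 1)) * 2 ^ (n - card (D i))"
        using cardD[OF that] D_le[of i] by (simp flip: power_add)
      ultimately show ?thesis using card_light_sets[OF D(2) cardD[OF that]] by simp
    qed
    then have "(\<Sum>i\<in>I. 2 ^ (n - (t + 1))) \<le> (\<Sum>i\<in>I. card (F i))" by (rule sum_mono)
    moreover have "card J = (\<Sum>i\<in>I. card (F i))"
      unfolding J_def using \<open>finite I\<close> N
      by (intro card_SigmaI) (auto simp: F_def intro: finite_subset[of _ "Pow N"])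
    ultimately show ?thesis by simp
  qed
  ultimately have "card I * 2 ^ (n - (t + 1)) \<le> 2 ^ n" using N by simp
  \<comment> \<open>A nonempty \<open>I\<close> provides some \<open>D i\<close> with more than
    \<open>t\<close> elements, so the subtraction in the exponent is not truncated.\<close>
  moreover have "t + 1 \<le> n" using False cardD D_le by (metis Suc_eq_plus1 Suc_leI equals0I order_less_le_trans)
  then have "(2::nat) ^ n = 2 ^ (t + 1) * 2 ^ (n - (t + 1))" by (simp flip: power_add power_Suc)
  ultimately show ?thesis by simp
qed simp

section \<open>Minimal subfamilies of balls\<close>

theorem theorem1p2:
  fixes n t m :: nat
    and X :: "'a set"
    and B :: "nat \<Rightarrow> (nat \<Rightarrow> 'a) set"
  assumes "t < n"
    and "infinite X \<or> card X \<ge> 2"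
    and "\<And>i. i \<in> {1..m} \<Longrightarrow> \<exists>x \<in> cart_power X n. B i = hamming_ball X n x t"
  shows "\<exists>I \<subseteq> {1..m}. card I \<le> 2 ^ (t + 1) \<and> (\<Inter>i\<in>{1..m}. B i) = (\<Inter>i\<in>I. B i)"
proof -
  define generates where "generates I \<longleftrightarrow> I \<subseteq> {1..m} \<and> (\<Inter>i\<in>{1..m}. B i) = (\<Inter>i\<in>I. B i)" for I
  have "generates {1..m}" by (simp add: generates_def)
  then obtain I where I: "generates I" and minimal: "\<And>I'. generates I' \<Longrightarrow> card I \<le> card I'"
    using ex_has_least_nat[of generates _ card] by blast
  have IN: "I \<subseteq> {1..m}" using I by (simp add: generates_def)
  then have "finite I" using finite_subset by blast
  obtain x where x: "\<And>i. i \<in> {1..m} \<Longrightarrow> B i = hamming_ball X n (x i) t"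
    using assms(3) by metis
  have "card I \<le> 2 ^ (t + 1)"
  proof (rule ccontr)
    assume large: "\<not> card I \<le> 2 ^ (t + 1)"
    have "(2::nat) \<le> 2 ^ (t + 1)" by simp
    with large have "2 < card I" by linarith
    \<comment> \<open>Dropping \<open>i\<close> must enlarge the intersection, by minimality; a new
      point becomes the partner of the centre \<open>x i\<close>.\<close>
    have "\<exists>p. (\<forall>j\<in>I - {i}. p \<in> B j) \<and> p \<notin> B i" if "i \<in> I" for i
    proof -
      have "card (I - {i}) < card I" using that \<open>finite I\<close> by (intro card_Diff1_less)
      then have "\<not> generates (I - {i})" using minimal[of "I - {i}"] by linarith
      then have "(\<Inter>j\<in>I. B j) \<noteq> (\<Inter>j\<in>I - {i}. B j)"
        using I by (auto simp: generates_def)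
      then show ?thesis using that by blast
    qed
    then obtain p where p: "\<And>i j. \<lbrakk>i \<in> I; j \<in> I - {i}\<rbrakk> \<Longrightarrow> p i \<in> B j"
        "\<And>i. i \<in> I \<Longrightarrow> p i \<notin> B i"
      by metis
    have "hamming_dist n (p i) (x j) \<le> t" if "i \<in> I" "j \<in> I" "i \<noteq> j" for i j
      using p(1)[of i j] x[of j] that IN by (auto simp: hamming_ball_def)
    moreover have "t < hamming_dist n (p i) (x i)" if "i \<in> I" for i
    proof -
      \<comment> \<open>Lying outside \<open>B i\<close> means being far from \<open>x i\<close>
        only for points of the cube; another ball containing \<open>p i\<close> places it
        there.\<close>
      have "card (I - {i}) \<noteq> 0" using that \<open>2 < card I\<close> by simp
      then obtain j where "j \<in> I - {i}" by (metis card.empty equals0I)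
      then have "p i \<in> hamming_ball X n (x j) t"
        using p(1)[OF that, of j] x[of j] IN by blast
      then have "p i \<in> cart_power X n" by (simp add: hamming_ball_def)
      then show ?thesis using p(2)[OF that] x[of i] that IN by (auto simp: hamming_ball_def)
    qed
    ultimately show False using card_pairs_le[OF \<open>finite I\<close>, of t n p x] large by blast
  qed
  then show ?thesis using I by (auto simp: generates_def)
qed

end
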